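(* Let $(f_n)_{n\in\mathbb{N}}$ be a sequence of functions $f_n:\mathbb{Z}\to\mathbb{C}$ such that $f_n$ is an even function (mod $n$) for every $n\in\mathbb{N}$ and $n\mapsto f_n(a)$ is multiplicative for every fixed $a\in\mathbb{Z}$. Let $n\in\mathbb{N}$ and $s,k\in\mathbb{Z}$ be such that $\nu_p(n)-\nu_p(k)\ne 1$ for every prime $p\mid n$. Write $n=n_1n_2$ with $n_1,n_2\in\mathbb{N}$, $(n_1,n_2)=1$, such that $\nu_p(n)\ge \nu_p(k)+2$ for every prime $p\mid n_1$, and $\nu_p(n)\le \nu_p(k)$ for every prime $p\mid n_2$. Then $$S_f(n,k,s) = e(ks/n)\,\varphi(n_2) \sum_{\substack{d\mid (n_1,k)\\ (n_1/d,s)=1}} d\,(\mu*f_{n_1})(n_1/d) \sum_{\substack{d\mid n_2\\ (d,s)=1}} \frac{(\mu*f_{n_2})(d)}{\varphi(d)}.$$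
   Context: $\mathbb{N}=\{1,2,\ldots\}$; $(a,b)$ is the greatest common divisor of $a,b\in\mathbb{Z}$; $\mu$ is the Möbius function; $\varphi$ is Euler's totient function; $e(x)=e^{2\pi i x}$ for $x\in\mathbb{R}$; $\nu_p(n)$ is the exponent of the prime $p$ in the prime factorization of $n\in\mathbb{Z}$, with the convention $\nu_p(0)=\infty$. All divisors in sums are positive. For fixed $n\in\mathbb{N}$, a function $f_n:\mathbb{Z}\to\mathbb{C}$ is an even function (mod $n$) if $f_n((a,n))=f_n(a)$ for every $a\in\mathbb{Z}$. For $d\in\mathbb{N}$, $(\mu*f_n)(d)=\sum_{ab=d,\ a,b\in\mathbb{N}}\mu(a)f_n(b)$ (Dirichlet convolution, with $f_n$ restricted to $\mathbb{N}$). For $n\in\mathbb{N}$ and $k,s\in\mathbb{Z}$, $$S_f(n,k,s):=\sum_{\substack{a=1\\ (a,n)=1}}^n f_n(a-s)\, e(ak/n).$$ The decomposition $n=n_1n_2$ exists and is unique under the stated hypothesis: $n_1$ is the product of the prime powers $p^{\nu_p(n)}$ over primes $p\mid n$ with $\nu_p(n)\ge\nu_p(k)+2$, and $n_2$ is the product of $p^{\nu_p(n)}$ over primes $p\mid n$ with $\nu_p(n)\le\nu_p(k)$. *)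

theory Defs
  imports
    Complex_Main
    "HOL-Library.Extended_Nat"
    "HOL-Computational_Algebra.Squarefree"
    "HOL-Number_Theory.Number_Theory"
begin

definition add_char :: "real \<Rightarrow> complex" where
  "add_char x = exp (2 * of_real pi * \<i> * of_real x)"

text \<open>Values lie in \<^typ>\<open>enat\<close>, so a difference of valuations is truncated at \<open>0\<close>, and subtracting
  \<open>\<infinity>\<close> from a finite valuation gives \<open>0\<close>. This does not affect a comparison of the difference
  with \<open>1\<close> when the minuend is finite.\<close>

definition nu :: "nat \<Rightarrow> int \<Rightarrow> enat" where
  "nu p x = (if x = 0 then \<infinity> else enat (multiplicity (int p) x))"

definition moebius_mu :: "nat \<Rightarrow> complex" where
  "moebius_mu n = (if squarefree n then (-1) ^ card (prime_factors n) else 0)"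

text \<open>Arithmetic functions have type \<^typ>\<open>nat \<Rightarrow> complex\<close>, but their domain is the
  positive integers: the value at \<open>0\<close> is irrelevant and never used.\<close>

definition multiplicative :: "(nat \<Rightarrow> complex) \<Rightarrow> bool" where
  "multiplicative g \<longleftrightarrow>
     g 1 = 1 \<and> (\<forall>m n. m > 0 \<longrightarrow> n > 0 \<longrightarrow> coprime m n \<longrightarrow> g (m * n) = g m * g n)"

definition dirichlet_conv :: "(nat \<Rightarrow> complex) \<Rightarrow> (nat \<Rightarrow> complex) \<Rightarrow> nat \<Rightarrow> complex" where
  "dirichlet_conv g h d = (\<Sum>(a, b) \<in> {(a, b). a > 0 \<and> b > 0 \<and> a * b = d}. g a * h b)"

definition even_mod :: "nat \<Rightarrow> (int \<Rightarrow> complex) \<Rightarrow> bool" where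
  "even_mod n g \<longleftrightarrow> (\<forall>a. g (gcd a (int n)) = g a)"

definition mu_conv :: "(int \<Rightarrow> complex) \<Rightarrow> nat \<Rightarrow> complex" where
  "mu_conv g = dirichlet_conv moebius_mu (\<lambda>b. g (int b))"

definition S_sum :: "(nat \<Rightarrow> int \<Rightarrow> complex) \<Rightarrow> nat \<Rightarrow> int \<Rightarrow> int \<Rightarrow> complex" where
  "S_sum f n k s =
     (\<Sum>a \<in> {a \<in> {1..n}. coprime a n}.
        f n (int a - s) * add_char (real a * real_of_int k / real n))"

end

theory Submission
  imports Defs
begin

text \<open>
  Multiplicativity gives \<open>f\<^sub>n = f\<^bsub>n1\<^esub> f\<^bsub>n2\<^esub>\<close>, and Moebius inversion writes each even factor as
  \<open>f\<^bsub>ni\<^esub>(x) = \<Sum>(\<mu> * f\<^bsub>ni\<^esub>)(d)\<close> over the common divisors \<open>d\<close> of \<open>ni\<close> and \<open>x\<close>. Inserting \<open>x = a - s\<close> and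
  exchanging summations expresses \<open>S\<^sub>f(n,k,s)\<close> through the sums \<open>T(d1 d2)\<close>, where \<open>d1\<close> and \<open>d2\<close> run
  through the divisors of \<open>n1\<close> and \<open>n2\<close> and \<open>T(d)\<close> sums \<open>e(ak/n)\<close> over the units \<open>a\<close> modulo \<open>n\<close> with
  \<open>a \<equiv> s (mod d)\<close> (\<open>S_sum_eq_progression_sums\<close>). The sums \<open>T(d)\<close> can be computed one by one.

  \<^item> If \<open>d\<close> and \<open>s\<close> are not coprime, the progression contains no units.
  \<^item> If they are coprime and \<open>n\<close> divides \<open>d k\<close>, all terms equal \<open>e(sk/n)\<close>, and the progression contains
    \<open>\<phi>(n)/\<phi>(d)\<close> units (\<open>card_unit_residues_progression\<close>).
  \<^item> If \<open>n\<close> does not divide \<open>d k\<close>, the obstruction is a prime \<open>p\<close> dividing \<open>n1\<close>, because \<open>n2\<close> divides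
    \<open>k\<close>. As \<open>p\<close> occurs in \<open>n\<close> at least twice more than in \<open>k\<close>, translation by
    \<open>h = n / p\<^sup>m\<close> with \<open>m = \<nu>\<^sub>p(k) + 1\<close> permutes the units in the progression and multiplies the sum
    by \<open>e(hk/n) \<noteq> 1\<close>, so it vanishes (\<open>progression_sum_eq_0\<close>).

  In the surviving terms \<open>d1\<close> has the same prime factors as \<open>n1\<close>, whence \<open>\<phi>(n1)/\<phi>(d1) = n1/d1\<close>.
  Each \<open>T(d1 d2)\<close> is thus a product of a function of \<open>d1\<close> and one of \<open>d2\<close>
  (\<open>progression_sum_eval\<close>), the double sum factors, and replacing \<open>d1\<close> by the complementary divisor
  of \<open>n1\<close> gives the stated formula.
\<close>

section \<open>Moebius inversion and even functions\<close>

lemma moebius_mu_prime_mult: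
  assumes "prime p" "\<not> p dvd d" "squarefree d"
  shows "moebius_mu (p * d) = - moebius_mu d"
proof -
  have d0: "d \<noteq> 0" using assms not_squarefree_0 by metis
  have cop: "coprime p d" using assms by (simp add: prime_imp_coprime)
  have "prime_factors (p * d) = insert p (prime_factors d)"
    using assms d0 by (auto simp: prime_factors_product prime_prime_factors)
  moreover have "p \<notin> prime_factors d" using assms by auto
  ultimately show ?thesis
    using cop assms by (simp add: moebius_mu_def squarefree_mult_coprime squarefree_prime)
qed

text \<open>Fix a prime \<open>p\<close> dividing \<open>n\<close>. Multiplication by \<open>p\<close> matches the squarefree divisors prime to
  \<open>p\<close> with those divisible by \<open>p\<close> and flips the sign, so the contributions cancel in pairs.\<close>

lemma sum_divisors_moebius_mu:
  assumes "n > 0"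
  shows "(\<Sum>d | d dvd n. moebius_mu d) = (if n = 1 then 1 else 0)"
proof (cases "n = 1")
  case True
  then show ?thesis by (simp add: moebius_mu_def)
next
  case False
  obtain p where p: "prime p" "p dvd n" using False prime_factor_nat by blast
  have fin: "finite {d. d dvd n}" using assms by simp
  let ?D0 = "{d. d dvd n \<and> squarefree d \<and> \<not> p dvd d}"
  let ?D1 = "{d. d dvd n \<and> squarefree d \<and> p dvd d}"
  have "bij_betw ((*) p) ?D0 ?D1"
  proof (rule bij_betwI')
    fix d d' assume "d \<in> ?D0" "d' \<in> ?D0"
    then show "p * d = p * d' \<longleftrightarrow> d = d'" using p by (auto simp: prime_gt_0_nat)
  next
    fix d assume d: "d \<in> ?D0"
    then have "coprime p d" using p by (simp add: prime_imp_coprime)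
    then show "p * d \<in> ?D1"
      using p d by (simp add: divides_mult squarefree_mult_coprime squarefree_prime)
  next
    fix d assume d: "d \<in> ?D1"
    then obtain e where e: "d = p * e" by auto
    have "\<not> p dvd e"
    proof
      assume "p dvd e"
      then have "p\<^sup>2 dvd d" using e by (simp add: power2_eq_square)
      then have "p dvd 1" using d squarefreeD by blast
      then show False using p by simp
    qed
    then have "e \<in> ?D0" using d e by (auto intro: dvd_mult_right dest: squarefree_multD)
    then show "\<exists>e\<in>?D0. d = p * e" using e by blast
  qed
  then have "(\<Sum>d\<in>?D1. moebius_mu d) = (\<Sum>d\<in>?D0. moebius_mu (p * d))"
    by (rule sum.reindex_bij_betw[symmetric])
  also have "\<dots> = - (\<Sum>d\<in>?D0. moebius_mu d)"
    using p by (simp add: moebius_mu_prime_mult sum_negf)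
  finally have cancel: "(\<Sum>d\<in>?D0. moebius_mu d) + (\<Sum>d\<in>?D1. moebius_mu d) = 0" by simp
  have "(\<Sum>d | d dvd n. moebius_mu d) = (\<Sum>d\<in>?D0 \<union> ?D1. moebius_mu d)"
    using fin by (intro sum.mono_neutral_right) (auto simp: moebius_mu_def)
  also have "\<dots> = (\<Sum>d\<in>?D0. moebius_mu d) + (\<Sum>d\<in>?D1. moebius_mu d)"
    using fin by (intro sum.union_disjoint) auto
  finally show ?thesis using cancel False by simp
qed

lemma sum_divisors_mu_conv:
  assumes "m > 0"
  shows "(\<Sum>d | d dvd m. mu_conv g d) = g (int m)"
proof -
  have fin: "finite {d. d dvd j}" if "j > 0" for j :: nat using that by simp
  have quot_pos: "a > 0" if "b dvd m" "a dvd m div b" for a b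
    using that assms by (metis dvd_div_eq_0_iff dvd_pos_nat gr0I less_numeral_extra(3))
  have sub: "{(a, b). a > 0 \<and> b > 0 \<and> a * b = d} \<subseteq> {..d} \<times> {..d}" for d :: nat
    by auto
  have "(\<Sum>d | d dvd m. mu_conv g d) =
      (\<Sum>(d, (a, b)) \<in> (SIGMA d:{d. d dvd m}. {(a, b). a > 0 \<and> b > 0 \<and> a * b = d}).
         moebius_mu a * g (int b))"
    unfolding mu_conv_def dirichlet_conv_def
    using fin[OF assms] by (subst sum.Sigma) (auto intro: finite_subset[OF sub])
  also have "\<dots> = (\<Sum>(b, a) \<in> (SIGMA b:{b. b dvd m}. {a. a dvd m div b}). moebius_mu a * g (int b))"
    by (rule sum.reindex_bij_witness
          [where i = "\<lambda>(b, a). (a * b, (a, b))" and j = "\<lambda>(d, (a, b)). (b, a)"])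
       (use assms in \<open>auto simp: dvd_div_iff_mult intro: dvd_mult_right gr0I dest: dvd_pos_nat quot_pos\<close>)
  also have "\<dots> = (\<Sum>b | b dvd m. \<Sum>a | a dvd m div b. moebius_mu a * g (int b))"
    using assms by (intro sum.Sigma[symmetric]) (auto simp: dvd_div_eq_0_iff)
  also have "\<dots> = (\<Sum>b | b dvd m. (if m div b = 1 then 1 else 0) * g (int b))"
  proof (intro sum.cong refl)
    fix b assume "b \<in> {b. b dvd m}"
    then have "m div b > 0" using assms by (auto elim!: dvdE)
    then show "(\<Sum>a | a dvd m div b. moebius_mu a * g (int b)) =
        (if m div b = 1 then 1 else 0) * g (int b)"
      by (simp only: sum_distrib_right[symmetric] sum_divisors_moebius_mu)
  qed
  also have "\<dots> = (\<Sum>b | b dvd m. if b = m then g (int b) else 0)"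
    using assms by (intro sum.cong) (auto simp: dvd_div_eq_iff elim!: dvdE)
  also have "\<dots> = g (int m)" using assms by simp
  finally show ?thesis .
qed

text \<open>Moebius inversion at \<open>gcd x n\<close>. It turns an even function into a combination of indicators of
  the progressions \<open>d dvd x\<close>, which is the only way evenness enters the evaluation.\<close>

lemma even_mod_eq_sum_mu_conv:
  assumes "even_mod n g" "n > 0"
  shows "g x = (\<Sum>d | d dvd n. if int d dvd x then mu_conv g d else 0)"
proof -
  define m where "m = nat (gcd x (int n))"
  have m: "int m = gcd x (int n)" "m > 0" using assms by (simp_all add: m_def)
  have dvd_m: "d dvd m \<longleftrightarrow> d dvd n \<and> int d dvd x" for d
    using m(1) by (metis gcd_greatest_iff int_dvd_int_iff)
  have "g x = g (int m)" using assms m by (simp add: even_mod_def)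
  also have "\<dots> = (\<Sum>d | d dvd m. mu_conv g d)" using m sum_divisors_mu_conv by simp
  also have "\<dots> = (\<Sum>d | d dvd n. if int d dvd x then mu_conv g d else 0)"
    using assms by (intro sum.mono_neutral_cong_left) (auto simp: dvd_m)
  finally show ?thesis .
qed

section \<open>The additive character on fractions\<close>

lemma add_char_add: "add_char (x + y) = add_char x * add_char y"
  by (simp add: add_char_def exp_add ring_distribs)

lemma add_char_eq_cis: "add_char x = cis (2 * pi * x)"
  by (simp add: add_char_def cis_conv_exp mult_ac)

lemma add_char_eq_1_iff: "add_char x = 1 \<longleftrightarrow> x \<in> \<int>"
proof
  assume "add_char x = 1"
  then have "cos (2 * pi * x) = 1" by (simp add: add_char_eq_cis complex_eq_iff)
  then obtain j :: int where "2 * pi * x = of_int j * 2 * pi" using cos_one_2pi_int by metis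
  then have "x = of_int j" by simp
  then show "x \<in> \<int>" by simp
next
  assume "x \<in> \<int>"
  then show "add_char x = 1"
    by (simp add: add_char_eq_cis cis_multiple_2pi)
qed

lemma add_char_fraction_eq_1_iff:
  assumes "n > 0"
  shows "add_char (real_of_int x / real n) = 1 \<longleftrightarrow> int n dvd x"
proof -
  have "real_of_int x / real n \<in> \<int> \<longleftrightarrow> int n dvd x"
  proof
    assume "real_of_int x / real n \<in> \<int>"
    then obtain j where "real_of_int x / real n = of_int j" by (elim Ints_cases)
    then have "real_of_int x = real_of_int (int n * j)" using assms by (simp add: field_simps)
    then show "int n dvd x" by (metis dvd_triv_left of_int_eq_iff)
  qed (use assms in \<open>auto elim!: dvdE\<close>)
  then show ?thesis by (simp add: add_char_eq_1_iff)
qed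

lemma add_char_fraction_add:
  "add_char (real_of_int (x + y) / real n) =
     add_char (real_of_int x / real n) * add_char (real_of_int y / real n)"
  by (simp add: add_char_add[symmetric] add_divide_distrib)

lemma add_char_fraction_cong:
  assumes "n > 0" "int n dvd x - y"
  shows "add_char (real_of_int x / real n) = add_char (real_of_int y / real n)"
proof -
  have "add_char (real_of_int (x - y) / real n) = 1"
    using assms by (simp only: add_char_fraction_eq_1_iff)
  with add_char_fraction_add[of y "x - y" n] show ?thesis by simp
qed

section \<open>Reduced residues in an arithmetic progression\<close>

text \<open>Representatives in \<open>{0..<n}\<close>, unlike the totatives in \<open>{1..n}\<close>, are the values of \<open>mod\<close> also for
  \<open>n = 1\<close>, and as integers they can be translated and multiplied freely.\<close>

definition unit_residues :: "nat \<Rightarrow> int set" where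
  "unit_residues n = {a \<in> {0..<int n}. coprime a (int n)}"

lemma finite_unit_residues [simp]: "finite (unit_residues n)"
  by (rule finite_subset[of _ "{0..<int n}"]) (auto simp: unit_residues_def)

lemma mod_in_unit_residues_iff:
  "n > 0 \<Longrightarrow> a mod int n \<in> unit_residues n \<longleftrightarrow> coprime a (int n)"
  by (simp add: unit_residues_def)

lemma bij_betw_totatives_unit_residues:
  assumes "n > 0"
  shows "bij_betw (\<lambda>a. int a mod int n) (totatives n) (unit_residues n)"
proof (cases "n = 1")
  case True
  then show ?thesis by (auto simp: unit_residues_def bij_betw_def)
next
  case False
  then have less: "a < n" if "a \<in> totatives n" for a
    using that assms totatives_less[of a n] by simp
  show ?thesis
  proof (rule bij_betwI')
    fix a assume "a \<in> totatives n"
    then show "int a mod int n \<in> unit_residues n"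
      using assms by (simp add: mod_in_unit_residues_iff in_totatives_iff)
  next
    fix x assume x: "x \<in> unit_residues n"
    have "x \<noteq> 0" using x False by (auto simp: unit_residues_def)
    with x have "nat x \<in> totatives n"
      by (auto simp: unit_residues_def in_totatives_iff coprime_int_iff[symmetric])
    moreover have "x = int (nat x) mod int n" using x by (simp add: unit_residues_def)
    ultimately show "\<exists>a\<in>totatives n. x = int a mod int n" by blast
  qed (simp add: less flip: zmod_int)
qed

lemma sum_totatives_eq_sum_unit_residues:
  assumes "n > 0" "\<And>x. F (x mod int n) = F x"
  shows "(\<Sum>a\<in>totatives n. F (int a)) = (\<Sum>a\<in>unit_residues n. F a)"
  using sum.reindex_bij_betw[OF bij_betw_totatives_unit_residues[OF assms(1)], of F]
  by (simp add: assms(2))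

lemma card_unit_residues: "n > 0 \<Longrightarrow> card (unit_residues n) = totient n"
  using bij_betw_same_card[OF bij_betw_totatives_unit_residues] by (simp add: totient_def)

text \<open>The change of variables used twice below: with \<open>g\<close> the multiplication by a unit to count units
  in a progression, and with \<open>g\<close> a translation to make a character sum vanish.\<close>

lemma sum_unit_residues_permute:
  assumes "n > 0" and periodic: "\<And>x. F (x mod int n) = F x"
    and unit: "\<And>a. coprime a (int n) \<Longrightarrow> coprime (g a) (int n)"
    and inj: "\<And>a b. [g a = g b] (mod int n) \<Longrightarrow> [a = b] (mod int n)"
  shows "(\<Sum>a\<in>unit_residues n. F (g a)) = (\<Sum>a\<in>unit_residues n. F a)"
proof -
  let ?h = "\<lambda>a. g a mod int n"
  have "?h ` unit_residues n \<subseteq> unit_residues n"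
  proof
    fix x assume "x \<in> ?h ` unit_residues n"
    then obtain a where "x = ?h a" "coprime a (int n)" by (auto simp: unit_residues_def)
    then show "x \<in> unit_residues n" using assms(1) unit by (simp add: mod_in_unit_residues_iff)
  qed
  moreover have "inj_on ?h (unit_residues n)"
  proof (rule inj_onI)
    fix a b assume "a \<in> unit_residues n" "b \<in> unit_residues n" "?h a = ?h b"
    then show "a = b" using inj[of a b] by (simp add: unit_residues_def cong_def)
  qed
  ultimately have "bij_betw ?h (unit_residues n) (unit_residues n)"
    by (simp add: bij_betw_def endo_inj_surj)
  from sum.reindex_bij_betw[OF this, of F] show ?thesis by (simp add: periodic)
qed

lemma coprime_int_if_no_common_prime:
  assumes "\<And>p. prime p \<Longrightarrow> p dvd n \<Longrightarrow> int p dvd x \<Longrightarrow> False"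
  shows "coprime x (int n)"
proof (rule ccontr)
  assume "\<not> coprime x (int n)"
  then have "nat (gcd x (int n)) \<noteq> 1" by (auto simp: coprime_iff_gcd_eq_1)
  then obtain p where p: "prime p" "p dvd nat (gcd x (int n))" using prime_factor_nat by blast
  have "int p dvd gcd x (int n)" using p(2) by (simp flip: int_dvd_int_iff)
  then show False using assms[OF p(1)] by simp
qed

text \<open>Surjectivity of the reduction map from units modulo \<open>n\<close> to units modulo \<open>d\<close>: \<open>s\<close> is
  shifted by a multiple of \<open>d\<close> that makes it prime to all of \<open>n\<close>.\<close>

lemma unit_residue_lift:
  assumes "n > 0" "coprime s (int d)"
  obtains u where "coprime u (int n)" "[u = s] (mod int d)"
proof -
  \<comment> \<open>Every prime factor of \<open>n\<close> divides exactly one of the two summands of \<open>s + d * t\<close>: a prime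
    dividing \<open>s\<close> divides neither \<open>d\<close> nor \<open>t\<close>, any other one divides \<open>t\<close>.\<close>
  define t where "t = \<Prod>{p \<in> prime_factors n. \<not> int p dvd s}"
  have "coprime (s + int d * int t) (int n)"
  proof (rule coprime_int_if_no_common_prime)
    fix p :: nat
    assume p: "prime p" and pn: "p dvd n" and sum: "int p dvd s + int d * int t"
    show False
    proof (cases "int p dvd s")
      case True
      with sum have "int p dvd int d * int t" by (simp add: dvd_add_right_iff)
      then have "p dvd d \<or> p dvd t" 
        using p by (metis int_dvd_int_iff of_nat_mult prime_dvd_mult_iff)
      moreover have "\<not> p dvd d"
        using True assms(2) p coprime_common_divisor[of s "int d" "int p"]
        by (auto simp: int_dvd_int_iff)
      moreover have "\<not> p dvd t"
      proof
        assume "p dvd t"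
        then obtain q where "q \<in> prime_factors n" "\<not> int q dvd s" "p dvd q"
          using p unfolding t_def by (auto simp: prime_dvd_prod_iff)
        then show False using True p primes_dvd_imp_eq by blast
      qed
      ultimately show False by blast
    next
      case False
      then have "p dvd t" using p pn assms(1) unfolding t_def
        by (intro dvd_prodI[where f = "\<lambda>x. x"]) (auto simp: prime_factors_dvd)
      then have "int p dvd int d * int t" by simp
      with sum False show False by (simp add: dvd_add_left_iff)
    qed
  qed
  moreover have "[s + int d * int t = s] (mod int d)" by (simp add: cong_def)
  ultimately show thesis by (rule that)
qed

text \<open>Multiplication by a unit lifting \<open>t\<close> carries the class of \<open>1\<close> modulo \<open>d\<close> to the class of \<open>t\<close>.
  Hence the \<open>\<phi>(n)\<close> units are equidistributed over the \<open>\<phi>(d)\<close> reduced classes modulo \<open>d\<close>.\<close>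

lemma card_unit_residues_progression:
  assumes "n > 0" "d dvd n" "coprime s (int d)"
  shows "card {a \<in> unit_residues n. [a = s] (mod int d)} * totient d = totient n"
proof -
  have d: "d > 0" using assms dvd_pos_nat by blast
  define N where "N t = (\<Sum>a\<in>unit_residues n. if [a = t] (mod int d) then 1 else 0::nat)" for t
  have N_const: "N t = N 1" if t: "coprime t (int d)" for t
  proof -
    obtain u where u: "coprime u (int n)" "[u = t] (mod int d)"
      using unit_residue_lift[OF assms(1) t] .
    have "[u * a = t] (mod int d) \<longleftrightarrow> [a = 1] (mod int d)" for a
    proof -
      have "[u * a = t] (mod int d) \<longleftrightarrow> [t * a = t * 1] (mod int d)"
        using cong_mult[OF u(2) cong_refl, of a] by (simp add: cong_def)
      then show ?thesis using cong_mult_lcancel[OF t, of a 1] by simp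
    qed
    then have "N 1 = (\<Sum>a\<in>unit_residues n. if [u * a = t] (mod int d) then 1 else 0)"
      by (simp add: N_def)
    also have "\<dots> = N t"
      unfolding N_def
    proof (rule sum_unit_residues_permute[OF assms(1)])
      show "(if [x mod int n = t] (mod int d) then 1 else 0) =
            (if [x = t] (mod int d) then 1 else (0::nat))" for x
        using assms(2) by (simp add: cong_def mod_mod_cancel)
    next
      fix a b assume "[u * a = u * b] (mod int n)"
      then show "[a = b] (mod int n)" using u(1) cong_mult_lcancel by blast
    qed (use u in simp)
    finally show ?thesis by simp
  qed
  have "totient n = (\<Sum>a\<in>unit_residues n. 1)" using assms(1) by (simp add: card_unit_residues)
  also have "\<dots> = (\<Sum>a\<in>unit_residues n. \<Sum>t\<in>unit_residues d. if [a = t] (mod int d) then 1 else 0)"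
  proof (intro sum.cong refl)
    fix a assume a: "a \<in> unit_residues n"
    have "coprime a (int d)"
      using a assms(2) by (auto simp: unit_residues_def intro: coprime_divisors[of a a "int d" "int n"])
    then have mem: "a mod int d \<in> unit_residues d" using d by (simp add: mod_in_unit_residues_iff)
    have "(\<Sum>t\<in>unit_residues d. if [a = t] (mod int d) then 1 else 0) =
        (\<Sum>t\<in>unit_residues d. if a mod int d = t then 1 else 0::nat)"
      by (intro sum.cong) (auto simp: cong_def unit_residues_def)
    then show "1 = (\<Sum>t\<in>unit_residues d. if [a = t] (mod int d) then 1 else 0::nat)"
      using mem by simp
  qed
  also have "\<dots> = (\<Sum>t\<in>unit_residues d. N t)" unfolding N_def by (rule sum.swap)
  also have "\<dots> = (\<Sum>t\<in>unit_residues d. N s)"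
  proof (rule sum.cong[OF refl])
    fix t assume "t \<in> unit_residues d"
    then have "coprime t (int d)" by (simp add: unit_residues_def)
    from N_const[OF this] N_const[OF assms(3)] show "N t = N s" by (rule trans[OF _ sym])
  qed
  also have "\<dots> = card {a \<in> unit_residues n. [a = s] (mod int d)} * totient d"
    using d by (simp add: card_unit_residues N_def sum.If_cases Int_def)
  finally show ?thesis by simp
qed

section \<open>Character sums over units in a progression\<close>

definition progression_sum :: "nat \<Rightarrow> int \<Rightarrow> int \<Rightarrow> nat \<Rightarrow> complex" where
  "progression_sum n k s d =
     (\<Sum>a\<in>unit_residues n. if [a = s] (mod int d) then add_char (real_of_int (a * k) / real n) else 0)"

lemma progression_summand_periodic:
  assumes "n > 0" "d dvd n"
  shows "(if [x mod int n = s] (mod int d) then add_char (real_of_int (x mod int n * k) / real n) else 0) =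
    (if [x = s] (mod int d) then add_char (real_of_int (x * k) / real n) else 0)"
proof -
  have "int n dvd x mod int n * k - x * k"
    unfolding left_diff_distrib[symmetric] by (intro dvd_mult2) (simp flip: mod_eq_dvd_iff)
  then have "add_char (real_of_int (x mod int n * k) / real n) = add_char (real_of_int (x * k) / real n)"
    by (rule add_char_fraction_cong[OF assms(1)])
  then show ?thesis using assms(2) by (simp add: cong_def mod_mod_cancel)
qed

lemma progression_sum_totatives:
  assumes "n > 0" "d dvd n"
  shows "(\<Sum>a\<in>totatives n.
      if [int a = s] (mod int d) then add_char (real_of_int (int a * k) / real n) else 0) =
    progression_sum n k s d"
  unfolding progression_sum_def
  by (rule sum_totatives_eq_sum_unit_residues[OF assms(1), where
        F = "\<lambda>x. if [x = s] (mod int d) then add_char (real_of_int (x * k) / real n) else 0"])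
     (rule progression_summand_periodic[OF assms])

lemma progression_sum_not_coprime:
  assumes "d dvd n" "\<not> coprime s (int d)"
  shows "progression_sum n k s d = 0"
  unfolding progression_sum_def
proof (intro sum.neutral ballI)
  fix a assume "a \<in> unit_residues n"
  then have "coprime a (int d)"
    using assms(1) by (auto simp: unit_residues_def intro: coprime_divisors[of a a "int d" "int n"])
  then have "\<not> [a = s] (mod int d)" using assms(2) cong_imp_coprime by blast
  then show "(if [a = s] (mod int d) then add_char (real_of_int (a * k) / real n) else 0) = 0"
    by simp
qed

text \<open>Here \<open>e(ak/n)\<close> depends only on \<open>a\<close> modulo \<open>d\<close>, so the summand is constant on the progression
  and the sum counts its units.\<close>

lemma progression_sum_constant:
  assumes "n > 0" "d dvd n" "coprime s (int d)" "int n dvd int d * k"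
  shows "progression_sum n k s d =
    add_char (real_of_int (s * k) / real n) * of_nat (totient n) / of_nat (totient d)"
proof -
  let ?A = "{a \<in> unit_residues n. [a = s] (mod int d)}"
  have d: "d > 0" using assms dvd_pos_nat by blast
  have "progression_sum n k s d = (\<Sum>a\<in>?A. add_char (real_of_int (a * k) / real n))"
    unfolding progression_sum_def by (rule sum.inter_filter[symmetric]) simp
  also have "\<dots> = (\<Sum>a\<in>?A. add_char (real_of_int (s * k) / real n))"
  proof (intro sum.cong refl add_char_fraction_cong[OF assms(1)])
    fix a assume "a \<in> ?A"
    then have "int d dvd a - s" by (simp add: cong_iff_dvd_diff)
    then have "int d * k dvd (a - s) * k" by (rule mult_dvd_mono[OF _ dvd_refl])
    with assms(4) have "int n dvd (a - s) * k" by (rule dvd_trans)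
    then show "int n dvd a * k - s * k" by (simp only: left_diff_distrib)
  qed
  also have "\<dots> = of_nat (card ?A) * add_char (real_of_int (s * k) / real n)"
    by (rule sum_constant)
  also have "of_nat (card ?A) = (of_nat (totient n) / of_nat (totient d) :: complex)"
  proof (rule eq_divide_imp)
    show "of_nat (card ?A) * of_nat (totient d) = (of_nat (totient n) :: complex)"
      unfolding of_nat_mult[symmetric] card_unit_residues_progression[OF assms(1-3)] ..
  qed (use d in simp)
  finally show ?thesis by (simp only: times_divide_eq_left mult.commute)
qed

lemma coprime_add_multiple_of_primes:
  assumes "\<And>p. prime p \<Longrightarrow> p dvd n \<Longrightarrow> p dvd h" "coprime a (int n)"
  shows "coprime (a + int h) (int n)"
proof (rule coprime_int_if_no_common_prime)
  fix p :: nat assume p: "prime p" "p dvd n" "int p dvd a + int h"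
  have "int p dvd int h" using assms(1) p by simp
  then have "int p dvd a" using p(3) by (simp add: dvd_add_left_iff)
  then show False using assms(2) p coprime_common_divisor[of a "int n" "int p"] by auto
qed

text \<open>Let \<open>h = n / p\<^sup>e\<^sup>+\<^sup>1\<close>. Translation by \<open>h\<close> preserves the progression because \<open>d\<close> divides \<open>h\<close>,
  and it preserves the units because every prime factor of \<open>n\<close> divides \<open>h\<close>; for \<open>p\<close> itself this
  is where the second spare power of \<open>p\<close> in \<open>n\<close> is used. It multiplies the sum by \<open>e(hk/n)\<close>, and
  \<open>hk/n = k / p\<^sup>e\<^sup>+\<^sup>1\<close> is not an integer, so the sum is zero. When \<open>p\<close> divides \<open>n\<close> just once more
  than \<open>k\<close>, the sum can be nonzero, as with Ramanujan sums to a prime modulus.\<close>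

lemma progression_sum_eq_0:
  assumes "n > 0" "prime p" "d * p ^ Suc e dvd n" "p ^ (e + 2) dvd n" "\<not> int (p ^ Suc e) dvd k"
  shows "progression_sum n k s d = 0"
proof -
  define h where "h = n div p ^ Suc e"
  have p0: "p ^ Suc e > 0" using assms(2) prime_gt_0_nat by simp
  have "p ^ Suc e dvd n" by (rule dvd_mult_right[OF assms(3)])
  then have n: "n = p ^ Suc e * h" unfolding h_def by (rule dvd_mult_div_cancel[symmetric])
  have dh: "d dvd h" using assms(3) p0 unfolding n by (simp add: mult.commute)
  have ph: "p dvd h" using assms(4) p0 unfolding n by simp
  have primes: "q dvd h" if "prime q" "q dvd n" for q
  proof -
    have "q dvd p ^ Suc e \<or> q dvd h" using that unfolding n by (simp only: prime_dvd_mult_iff)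
    then have "q dvd p \<or> q dvd h" using that(1) prime_dvd_power by blast
    then show ?thesis using ph dvd_trans by blast
  qed
  define c where "c = add_char (real_of_int (int h * k) / real n)"
  have "\<not> int n dvd int h * k"
    using assms(1,5) unfolding n by (simp add: mult.commute)
  then have c: "c \<noteq> 1"
    unfolding c_def using assms(1) by (simp only: add_char_fraction_eq_1_iff not_False_eq_True)
  define F where "F a = (if [a = s] (mod int d) then add_char (real_of_int (a * k) / real n) else 0)" for a
  have dn: "d dvd n" using dh n by simp
  have "progression_sum n k s d = (\<Sum>a\<in>unit_residues n. F (a + int h))"
    unfolding progression_sum_def F_def[symmetric]
  proof (rule sum_unit_residues_permute[OF assms(1), symmetric])
    show "F (x mod int n) = F x" for x
      unfolding F_def by (rule progression_summand_periodic[OF assms(1) dn])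
    show "coprime (a + int h) (int n)" if "coprime a (int n)" for a
      using coprime_add_multiple_of_primes[OF primes that] .
    show "[a = b] (mod int n)" if "[a + int h = b + int h] (mod int n)" for a b
      using that cong_add_rcancel by blast
  qed
  also have "\<dots> = (\<Sum>a\<in>unit_residues n. c * F a)"
  proof (intro sum.cong refl)
    fix a
    have "[a + int h = s] (mod int d) \<longleftrightarrow> [a = s] (mod int d)"
      using dh dvd_add_left_iff[of "int d" "int h" "a - s"] by (simp add: cong_iff_dvd_diff algebra_simps)
    moreover have "add_char (real_of_int ((a + int h) * k) / real n) =
        c * add_char (real_of_int (a * k) / real n)"
      unfolding c_def ring_distribs add_char_fraction_add by (rule mult.commute)
    ultimately show "F (a + int h) = c * F a" by (simp add: F_def)
  qed
  also have "\<dots> = c * progression_sum n k s d"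
    unfolding progression_sum_def F_def by (rule sum_distrib_left[symmetric])
  finally show ?thesis using c by simp
qed

lemma totient_quotient_same_primes:
  assumes "n > 0" "d dvd n" "\<And>p. prime p \<Longrightarrow> p dvd n \<Longrightarrow> p dvd d"
  shows "totient n = n div d * totient d"
proof -
  have d: "d > 0" using assms dvd_pos_nat by blast
  have "prime_factors n = prime_factors d"
    using assms d by (auto simp: prime_factors_dvd dvd_trans)
  then have "real (totient n) = real (n div d * totient d)"
    using d assms(2) by (simp add: totient_formula2 real_of_nat_div field_simps)
  then show ?thesis by (simp only: of_nat_eq_iff)
qed

text \<open>The failure of divisibility is visible at a single prime \<open>p\<close>. The exponent is the least one for
  which the power of \<open>p\<close> does not divide \<open>k\<close>, so that the translation argument asks for as few
  spare factors \<open>p\<close> as possible.\<close>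

lemma prime_power_separating:
  fixes k :: int
  assumes "c > 0" "k \<noteq> 0" "\<not> int c dvd k"
  obtains p where "prime p" "p ^ Suc (multiplicity (int p) k) dvd c"
proof -
  obtain q where q: "prime q" "\<not> multiplicity q (int c) \<le> multiplicity q k"
    using assms multiplicity_le_imp_dvd[of "int c" k] by auto
  define p where "p = nat q"
  have qp: "q = int p" using q(1) by (simp add: p_def prime_ge_0_int)
  have "q ^ Suc (multiplicity q k) dvd int c" using q(2) by (intro multiplicity_dvd') simp
  then show thesis using that[of p] q(1) by (simp add: qp flip: of_nat_power of_nat_mult)
qed

text \<open>The cases combine into a product of a factor in \<open>d1\<close> and a factor in \<open>d2\<close>, which is what makes
  the double sum over divisors factor. If \<open>n1\<close> divides \<open>d1 k\<close>, then \<open>d1\<close> contains all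
  primes of \<open>n1\<close>, since a missing prime would have to be absorbed by \<open>k\<close> alone; therefore
  \<open>\<phi>(n1)/\<phi>(d1)\<close> is simply \<open>n1/d1\<close>. Otherwise \<open>n1/d1\<close> does not divide \<open>k\<close>, and a prime witnessing
  this makes the sum vanish.\<close>

lemma progression_sum_eval:
  fixes k s :: int
  assumes n: "n1 > 0" "n2 > 0" "coprime n1 n2"
    and high: "\<And>p. prime p \<Longrightarrow> p dvd n1 \<Longrightarrow> k \<noteq> 0 \<and> p ^ (multiplicity (int p) k + 2) dvd n1"
    and low: "int n2 dvd k"
    and d: "d1 dvd n1" "d2 dvd n2"
  shows "progression_sum (n1 * n2) k s (d1 * d2) =
    add_char (real_of_int (s * k) / real (n1 * n2)) * of_nat (totient n2) *
    (if coprime s (int d1) \<and> int n1 dvd int d1 * k then of_nat (n1 div d1) else 0) *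
    (if coprime s (int d2) then 1 / of_nat (totient d2) else 0)"
proof (cases "coprime s (int d1) \<and> coprime s (int d2)")
  case False
  moreover have "\<not> coprime s (int (d1 * d2))" using False by auto
  then have "progression_sum (n1 * n2) k s (d1 * d2) = 0"
    using d by (intro progression_sum_not_coprime mult_dvd_mono)
  ultimately show ?thesis by auto
next
  case cop: True
  have d0: "d1 > 0" "d2 > 0" using d n by (auto intro: dvd_pos_nat)
  have dn: "d1 * d2 dvd n1 * n2" using d by (rule mult_dvd_mono)
  have coprime_d: "coprime d1 d2" using coprime_divisors[OF d n(3)] .
  have not_dvd: "\<not> int (p ^ Suc (multiplicity (int p) k)) dvd k" if "prime p" "k \<noteq> 0" for p
  proof -
    have "\<not> is_unit (int p)" using that prime_gt_1_nat[of p] by simp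
    from power_dvd_iff_le_multiplicity[OF that(2) this] show ?thesis
      by (simp del: power_Suc)
  qed
  show ?thesis
  proof (cases "int n1 dvd int d1 * k")
    case True
    have "p dvd d1" if p: "prime p" "p dvd n1" for p
    proof (rule ccontr)
      let ?e = "multiplicity (int p) k"
      assume "\<not> p dvd d1"
      then have "coprime (p ^ (?e + 2)) d1" using p by (simp add: prime_imp_coprime)
      then have "coprime (int (p ^ (?e + 2))) (int d1)" by (simp only: coprime_int_iff)
      moreover have "int (p ^ (?e + 2)) dvd int d1 * k"
        using high[OF p] True by (meson dvd_trans int_dvd_int_iff)
      ultimately have "int (p ^ (?e + 2)) dvd k" by (simp only: coprime_dvd_mult_right_iff)
      moreover have "int (p ^ Suc ?e) dvd int (p ^ (?e + 2))"
        unfolding int_dvd_int_iff by (intro le_imp_power_dvd) simp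
      ultimately have "int (p ^ Suc ?e) dvd k" by (rule dvd_trans[rotated])
      then show False using not_dvd[OF p(1)] high[OF p] by simp
    qed
    then have tot1: "totient n1 = n1 div d1 * totient d1"
      using totient_quotient_same_primes[OF n(1) d(1)] by simp
    have "int n1 * int n2 dvd int (d1 * d2) * k"
    proof (rule divides_mult)
      have "int n1 dvd int d2 * (int d1 * k)" using True by (rule dvd_mult)
      then show "int n1 dvd int (d1 * d2) * k" by (simp add: mult_ac)
      show "int n2 dvd int (d1 * d2) * k" using low by (rule dvd_mult)
    qed (use n in simp)
    then have "progression_sum (n1 * n2) k s (d1 * d2) =
        add_char (real_of_int (s * k) / real (n1 * n2)) * of_nat (totient (n1 * n2)) /
          of_nat (totient (d1 * d2))"
      using n dn cop by (intro progression_sum_constant) simp_all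
    also have "totient (n1 * n2) = (n1 div d1 * totient d1) * totient n2"
      using n by (simp add: totient_mult_coprime tot1)
    also have "totient (d1 * d2) = totient d1 * totient d2"
      using coprime_d by (rule totient_mult_coprime)
    finally show ?thesis using d0 cop True by simp
  next
    case False
    define c where "c = n1 div d1"
    have c: "n1 = d1 * c" "c > 0" using d n by (auto simp: c_def elim!: dvdE)
    have "\<not> int c dvd k" using False d0 by (auto simp: c)
    moreover from this have k0: "k \<noteq> 0" by auto
    ultimately obtain p where p: "prime p" "p ^ Suc (multiplicity (int p) k) dvd c"
      using prime_power_separating[OF c(2)] by blast
    have "p dvd c" by (rule dvd_trans[OF _ p(2)]) simp
    then have "p dvd n1" unfolding c(1) by (rule dvd_mult)
    have "progression_sum (n1 * n2) k s (d1 * d2) = 0"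
    proof (rule progression_sum_eq_0[OF _ p(1)])
      have "d1 * d2 * p ^ Suc (multiplicity (int p) k) = d1 * p ^ Suc (multiplicity (int p) k) * d2"
        by (simp only: mult_ac)
      also have "\<dots> dvd n1 * n2" unfolding c(1) using p(2) d(2) by (intro mult_dvd_mono dvd_refl)
      finally show "d1 * d2 * p ^ Suc (multiplicity (int p) k) dvd n1 * n2" .
      show "p ^ (multiplicity (int p) k + 2) dvd n1 * n2"
        using high[OF p(1) \<open>p dvd n1\<close>] by (intro dvd_mult2) simp
    qed (use n not_dvd[OF p(1) k0] in \<open>simp_all del: power_Suc\<close>)
    then show ?thesis using False by simp
  qed
qed

section \<open>Evaluation of the sum\<close>

text \<open>Since \<open>d1\<close> and \<open>d2\<close> are coprime, the two divisibility conditions merge into a single progression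
  modulo \<open>d1 * d2\<close>; the sum over units then never has to be split along \<open>n = n1 * n2\<close>.\<close>

lemma even_mod_product_expansion:
  assumes even: "even_mod n1 g1" "even_mod n2 g2"
    and n: "n1 > 0" "n2 > 0" "coprime n1 n2"
  shows "g1 (x - s) * g2 (x - s) = (\<Sum>d1 | d1 dvd n1. \<Sum>d2 | d2 dvd n2.
    mu_conv g1 d1 * mu_conv g2 d2 * (if [x = s] (mod int (d1 * d2)) then 1 else 0))"
proof -
  have "g1 (x - s) * g2 (x - s) = (\<Sum>d1 | d1 dvd n1. \<Sum>d2 | d2 dvd n2.
      (if int d1 dvd x - s then mu_conv g1 d1 else 0) *
      (if int d2 dvd x - s then mu_conv g2 d2 else 0))"
    using even_mod_eq_sum_mu_conv[OF even(1) n(1), of "x - s"]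
      even_mod_eq_sum_mu_conv[OF even(2) n(2), of "x - s"]
    by (simp add: sum_product)
  also have "\<dots> = (\<Sum>d1 | d1 dvd n1. \<Sum>d2 | d2 dvd n2.
    mu_conv g1 d1 * mu_conv g2 d2 * (if [x = s] (mod int (d1 * d2)) then 1 else 0))"
  proof (intro sum.cong refl)
    fix d1 d2 assume "d1 \<in> {d. d dvd n1}" "d2 \<in> {d. d dvd n2}"
    then have "coprime d1 d2" using coprime_divisors[OF _ _ n(3)] by simp
    then have "int (d1 * d2) dvd x - s \<longleftrightarrow> int d1 dvd x - s \<and> int d2 dvd x - s"
      by (auto intro: divides_mult dvd_mult_left dvd_mult_right)
    then show "(if int d1 dvd x - s then mu_conv g1 d1 else 0) *
      (if int d2 dvd x - s then mu_conv g2 d2 else 0) =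
      mu_conv g1 d1 * mu_conv g2 d2 * (if [x = s] (mod int (d1 * d2)) then 1 else 0)"
      by (simp add: cong_iff_dvd_diff)
  qed
  finally show ?thesis .
qed

lemma S_sum_eq_progression_sums:
  assumes even: "even_mod n1 (f n1)" "even_mod n2 (f n2)"
    and product: "\<And>a. f (n1 * n2) a = f n1 a * f n2 a"
    and n: "n1 > 0" "n2 > 0" "coprime n1 n2"
  shows "S_sum f (n1 * n2) k s = (\<Sum>d1 | d1 dvd n1. \<Sum>d2 | d2 dvd n2.
    mu_conv (f n1) d1 * mu_conv (f n2) d2 * progression_sum (n1 * n2) k s (d1 * d2))"
proof -
  let ?n = "n1 * n2"
  let ?E = "\<lambda>a. add_char (real_of_int (int a * k) / real ?n)"
  let ?g = "\<lambda>d1 d2. mu_conv (f n1) d1 * mu_conv (f n2) d2"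
  have tot: "{a \<in> {1..?n}. coprime a ?n} = totatives ?n"
    by (auto simp only: in_totatives_iff mem_Collect_eq atLeastAtMost_iff Suc_le_eq One_nat_def)
  have "S_sum f ?n k s = (\<Sum>a\<in>totatives ?n. f ?n (int a - s) * ?E a)"
    unfolding S_sum_def tot by simp
  also have "\<dots> = (\<Sum>a\<in>totatives ?n. \<Sum>d1 | d1 dvd n1. \<Sum>d2 | d2 dvd n2.
      ?g d1 d2 * (if [int a = s] (mod int (d1 * d2)) then ?E a else 0))"
    unfolding product even_mod_product_expansion[OF even n] sum_distrib_right
    by (intro sum.cong refl) simp
  also have "\<dots> = (\<Sum>d1 | d1 dvd n1. \<Sum>a\<in>totatives ?n. \<Sum>d2 | d2 dvd n2.
      ?g d1 d2 * (if [int a = s] (mod int (d1 * d2)) then ?E a else 0))"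
    by (rule sum.swap)
  also have "\<dots> = (\<Sum>d1 | d1 dvd n1. \<Sum>d2 | d2 dvd n2. \<Sum>a\<in>totatives ?n.
      ?g d1 d2 * (if [int a = s] (mod int (d1 * d2)) then ?E a else 0))"
    by (rule sum.cong[OF refl], rule sum.swap)
  also have "\<dots> = (\<Sum>d1 | d1 dvd n1. \<Sum>d2 | d2 dvd n2. ?g d1 d2 * progression_sum ?n k s (d1 * d2))"
  proof (intro sum.cong refl)
    fix d1 d2 assume "d1 \<in> {d. d dvd n1}" "d2 \<in> {d. d dvd n2}"
    then have "d1 * d2 dvd ?n" by (auto intro: mult_dvd_mono)
    then show "(\<Sum>a\<in>totatives ?n. ?g d1 d2 * (if [int a = s] (mod int (d1 * d2)) then ?E a else 0)) =
        ?g d1 d2 * progression_sum ?n k s (d1 * d2)"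
      using n by (simp only: sum_distrib_left[symmetric] progression_sum_totatives nat_0_less_mult_iff simp_thms)
  qed
  finally show ?thesis .
qed

lemma nu_add_2_le_imp_power_dvd:
  assumes "prime p" "n > 0" "nu p (int n) \<ge> nu p k + 2"
  shows "k \<noteq> 0" "p ^ (multiplicity (int p) k + 2) dvd n"
proof -
  show k: "k \<noteq> 0" using assms(2,3) by (auto simp: nu_def)
  have "enat (multiplicity (int p) k + 2) \<le> enat (multiplicity (int p) (int n))"
    using assms(2,3) k by (simp add: nu_def numeral_eq_enat)
  then have "int p ^ (multiplicity (int p) k + 2) dvd int n"
    by (intro multiplicity_dvd') simp
  then show "p ^ (multiplicity (int p) k + 2) dvd n"
    by (simp only: int_dvd_int_iff flip: of_nat_power)
qed

text \<open>At the primes dividing \<open>m\<close> the valuation of \<open>m\<close> is at most that of \<open>n\<close>; all other primes are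
  trivial.\<close>

lemma nu_le_imp_dvd:
  assumes "n > 0" "m dvd n"
    and "\<And>p. prime p \<Longrightarrow> p dvd m \<Longrightarrow> nu p (int n) \<le> nu p k"
  shows "int m dvd k"
proof (cases "k = 0")
  case False
  show ?thesis
  proof (rule multiplicity_le_imp_dvd)
    fix q :: int assume q: "prime q"
    define p where "p = nat q"
    have qp: "q = int p" using q by (simp add: p_def prime_ge_0_int)
    have p: "prime p" using q by (simp add: qp)
    show "multiplicity q (int m) \<le> multiplicity q k"
    proof (cases "p dvd m")
      case True
      have "multiplicity q (int m) \<le> multiplicity q (int n)"
        using assms(1,2) by (intro dvd_imp_multiplicity_le) auto
      also have "\<dots> \<le> multiplicity q k"
        using assms(3)[OF p True] assms(1) False by (simp add: nu_def qp)
      finally show ?thesis .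
    next
      case False
      then show ?thesis by (simp add: qp not_dvd_imp_multiplicity_0)
    qed
  qed (use assms dvd_pos_nat in auto)
qed simp

theorem theorem3p6:
  fixes f :: "nat \<Rightarrow> int \<Rightarrow> complex"
    and n n1 n2 :: nat
    and k s :: int
  assumes f_even: "\<And>m. m > 0 \<Longrightarrow> even_mod m (f m)"
    and f_mult: "\<And>a. multiplicative (\<lambda>m. f m a)"
    and n_pos: "n > 0"
    and nu_diff: "\<And>p. prime p \<Longrightarrow> p dvd n \<Longrightarrow> nu p (int n) - nu p k \<noteq> 1"
    and n_eq: "n = n1 * n2"
    and n1_pos: "n1 > 0"
    and n2_pos: "n2 > 0"
    and n12_coprime: "coprime n1 n2"
    and nu_n1: "\<And>p. prime p \<Longrightarrow> p dvd n1 \<Longrightarrow> nu p (int n) \<ge> nu p k + 2"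
    and nu_n2: "\<And>p. prime p \<Longrightarrow> p dvd n2 \<Longrightarrow> nu p (int n) \<le> nu p k"
  shows "S_sum f n k s =
    add_char (real_of_int k * real_of_int s / real n) * of_nat (totient n2) *
    (\<Sum>d \<in> {d::nat. int d dvd gcd (int n1) k \<and> coprime (int (n1 div d)) s}.
       of_nat d * mu_conv (f n1) (n1 div d)) *
    (\<Sum>d \<in> {d::nat. d dvd n2 \<and> coprime (int d) s}.
       mu_conv (f n2) d / of_nat (totient d))"
proof -
  have low: "int n2 dvd k"
    by (rule nu_le_imp_dvd[OF n_pos _ nu_n2]) (simp_all add: n_eq)
  have high: "k \<noteq> 0 \<and> p ^ (multiplicity (int p) k + 2) dvd n1" if p: "prime p" "p dvd n1" for p
  proof -
    note * = nu_add_2_le_imp_power_dvd[OF p(1) n_pos nu_n1[OF p]]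
    have "\<not> p dvd n2" using p n12_coprime coprime_common_divisor_nat[of n1 n2 p] by auto
    then have "coprime (p ^ (multiplicity (int p) k + 2)) n2"
      using p(1) by (simp only: coprime_power_left_iff prime_imp_coprime simp_thms)
    with * show ?thesis unfolding n_eq by (simp only: coprime_dvd_mult_left_iff simp_thms)
  qed
  let ?E = "add_char (real_of_int (s * k) / real n)"
  let ?A = "\<lambda>d. if coprime s (int d) \<and> int n1 dvd int d * k then of_nat (n1 div d) else (0::complex)"
  let ?B = "\<lambda>d. if coprime s (int d) then 1 / of_nat (totient d) else (0::complex)"
  have fin: "finite {d. d dvd n1}" "finite {d. d dvd n2}" using n1_pos n2_pos by simp_all
  have even: "even_mod n1 (f n1)" "even_mod n2 (f n2)" using f_even n1_pos n2_pos by blast+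
  have product: "f (n1 * n2) a = f n1 a * f n2 a" for a
    using f_mult[of a] n1_pos n2_pos n12_coprime by (simp add: multiplicative_def)
  have "S_sum f n k s = (\<Sum>d1 | d1 dvd n1. \<Sum>d2 | d2 dvd n2.
      mu_conv (f n1) d1 * mu_conv (f n2) d2 * (?E * of_nat (totient n2) * ?A d1 * ?B d2))"
    unfolding n_eq S_sum_eq_progression_sums[OF even product n1_pos n2_pos n12_coprime]
  proof (intro sum.cong refl)
    fix d1 d2 assume "d1 \<in> {d. d dvd n1}" "d2 \<in> {d. d dvd n2}"
    then have d: "d1 dvd n1" "d2 dvd n2" by simp_all
    have eval: "progression_sum (n1 * n2) k s (d1 * d2) =
        add_char (real_of_int (s * k) / real (n1 * n2)) * of_nat (totient n2) * ?A d1 * ?B d2"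
      by (rule progression_sum_eval[OF n1_pos n2_pos n12_coprime high low d])
    show "mu_conv (f n1) d1 * mu_conv (f n2) d2 * progression_sum (n1 * n2) k s (d1 * d2) =
      mu_conv (f n1) d1 * mu_conv (f n2) d2 *
        (add_char (real_of_int (s * k) / real (n1 * n2)) * of_nat (totient n2) * ?A d1 * ?B d2)"
      by (simp only: eval)
  qed
  also have "\<dots> = ?E * of_nat (totient n2) *
      ((\<Sum>d | d dvd n1. ?A d * mu_conv (f n1) d) * (\<Sum>d | d dvd n2. mu_conv (f n2) d * ?B d))"
    unfolding sum_product
    unfolding sum_distrib_left by (intro sum.cong refl) (simp only: mult_ac)
  also have "(\<Sum>d | d dvd n2. mu_conv (f n2) d * ?B d) =
      (\<Sum>d | d dvd n2 \<and> coprime (int d) s. mu_conv (f n2) d / of_nat (totient d))"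
    using fin by (intro sum.mono_neutral_cong_right) (auto simp: coprime_commute)
  \<comment> \<open>Passing to the complementary divisor turns the condition \<open>n1 dvd d * k\<close> into \<open>d dvd k\<close>.\<close>
  also have "(\<Sum>d | d dvd n1. ?A d * mu_conv (f n1) d) =
      (\<Sum>d | d dvd n1. ?A (n1 div d) * mu_conv (f n1) (n1 div d))"
    using n1_pos
    by (intro sum.reindex_bij_witness[where i = "\<lambda>d. n1 div d" and j = "\<lambda>d. n1 div d"])
       (auto elim!: dvdE)
  also have "\<dots> = (\<Sum>d | int d dvd gcd (int n1) k \<and> coprime (int (n1 div d)) s.
      of_nat d * mu_conv (f n1) (n1 div d))"
  proof (rule sum.mono_neutral_cong_right[OF fin(1)])
    have A: "?A (n1 div d) = (if int d dvd k \<and> coprime (int (n1 div d)) s then of_nat d else 0)"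
      if "d dvd n1" for d
    proof -
      from that obtain c where c: "n1 = d * c" by (rule dvdE)
      have "d > 0" "c > 0" using n1_pos c by auto
      then show ?thesis by (auto simp: c coprime_commute mult.commute[of "int d"])
    qed
    show "\<forall>d\<in>{d. d dvd n1} - {d. int d dvd gcd (int n1) k \<and> coprime (int (n1 div d)) s}.
        ?A (n1 div d) * mu_conv (f n1) (n1 div d) = 0"
    proof
      fix d assume "d \<in> {d. d dvd n1} - {d. int d dvd gcd (int n1) k \<and> coprime (int (n1 div d)) s}"
      then have "d dvd n1" "\<not> (int d dvd k \<and> coprime (int (n1 div d)) s)" by auto
      then show "?A (n1 div d) * mu_conv (f n1) (n1 div d) = 0" by (simp only: A if_False mult_zero_left)
    qed
    fix d assume "d \<in> {d. int d dvd gcd (int n1) k \<and> coprime (int (n1 div d)) s}"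
    then have "d dvd n1" "int d dvd k \<and> coprime (int (n1 div d)) s" by auto
    then show "?A (n1 div d) * mu_conv (f n1) (n1 div d) = of_nat d * mu_conv (f n1) (n1 div d)"
      by (simp only: A if_True simp_thms)
  qed auto
  finally show ?thesis by (simp add: mult.assoc mult.commute[of "real_of_int s"])
qed

end
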